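(* Let $\mathcal X\times\mathcal Y$ be a compact subset of $\mathbb R^{d_x}\times\mathbb R^{d_y}$, let $P$ be the joint distribution of $(X,Y)$ on $\mathcal X\times\mathcal Y$, let $(x_i,y_i)$, $i\ge1$, be i.i.d. samples of $(X,Y)$ and $P^N=\frac1N\sum_{i=1}^N\delta_{(x_i,y_i)}$. Let $\mathcal H$ be the reproducing kernel Hilbert space generated by a (continuous) universal kernel $k$ on $\mathcal X$ and $\mathcal H^{d_z}$ the Cartesian product of $d_z$ copies of $\mathcal H$. Let $h:\mathbb R^{d_z}\times\mathbb R\times\mathbb R^{d_y}\to\mathbb R$ be continuous, and let $(z^*(\cdot),s^*(\cdot))$ be an optimal solution of $$\min_{(z(\cdot),s(\cdot))\in\mathcal C(\mathcal X)^{d_z}\times\mathcal C(\mathcal X)}\mathbb E_P[h(z(X),s(X),Y)].$$ Assume that (d) for every compact set $\mathcal Z_0\times\mathcal S_0\subseteq\mathbb R^{d_z}\times\mathbb R$ there exist a continuous function $r:\mathcal Y\to\mathbb R_+$ with $\bar r:=\mathbb E_P[r(Y)]<\infty$ and a constant $\nu\in(0,1)$ such that $|h(z_1,s_1,y)-h(z_2,s_2,y)|\le r(y)\big(\|z_1-z_2\|+|s_1-s_2|\big)^\nu$ for all $z_1,z_2\in\mathcal Z_0$, $s_1,s_2\in\mathcal S_0$, $y\in\mathcal Y$. Then: (i) For any $\delta_1>0$ there exists $(\hat z(\cdot),\hat s(\cdot))\in\mathcal H^{d_z}\times\mathcal H$ such that $$\mathbb E_P[h(\hat z(X),\hat s(X),Y)]-\mathbb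 E_P[h(z^*(X),s^*(X),Y)]\le\delta_1.$$ (ii) Let $\delta_1>0$ and $(\hat z,\hat s)$ be as in (i), put $\beta_1:=\|\hat z\|_{\mathcal H^{d_z}}$, $\beta_2:=\|\hat s\|_{\mathcal H}$, let $\bar{\mathcal H}_z^{d_z}=\{z\in\mathcal H^{d_z}:\|z\|_{\mathcal H^{d_z}}\le\beta_1\}$, $\bar{\mathcal H}_s=\{s\in\mathcal H:\|s\|_{\mathcal H}\le\beta_2\}$, and $$\vartheta_N(P^N,\lambda_N)=\min_{(z,s)\in\bar{\mathcal H}_z^{d_z}\times\bar{\mathcal H}_s}\Big\{\mathbb E_{P^N}[h(z(X),s(X),Y)]+\lambda_N\big(\|z\|_{\mathcal H^{d_z}}^2+\|s\|_{\mathcal H}^2\big)\Big\},\quad\lambda_N>0.$$ Suppose in addition that: (a) there is a continuous $\phi:\mathcal X\times\mathcal Y\to\mathbb R_+$ with $|h(z(x),s(x),y)|\le\phi(x,y)$ for all $z\in\bar{\mathcal H}_z^{d_z}$, $s\in\bar{\mathcal H}_s$, $(x,y)\in\mathcal X\times\mathcal Y$, $\int\phi\,dP<\infty$, and $\phi(x,y)\to\infty$ as $\|(x,y)\|\to\infty$ (the last condition being vacuous here since $\mathcal X\times\mathcal Y$ is compact); (c) for every compact $\mathcal X_0\subseteq\mathcal X$ and $\epsilon>0$ there is $\eta_\epsilon>0$ such that $\|k(\cdot,x')-k(\cdot,x)\|_{\mathcal H}\le\epsilon$ for all $x,x'\in\mathcal X_0$ with $\|x'-x\|\le\eta_\epsilon$;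 (e) $\mathbb E_P\big[e^{t(h(z(X),s(X),Y)-\mathbb E_P[h(z(X),s(X),Y)])}\big]$ is finite for all $z\in\bar{\mathcal H}_z^{d_z}$, $s\in\bar{\mathcal H}_s$ and $t$ in a neighborhood of zero. Then for any $\delta_2>0$ there exist positive constants $N_0$, $\epsilon<\frac{\delta_2}{6}$, $\hat C(\epsilon,\delta_2,\delta_1)$ and $\hat\beta(\epsilon,\delta_2,\delta_1)$, independent of $N$, such that for all $N>N_0$ and $\lambda_N\le\epsilon/(\beta_1^2+\beta_2^2)$, $$\mathrm{Prob}\Big(\big|\vartheta_N(P^N,\lambda_N)-\mathbb E_P[h(z^*(X),s^*(X),Y)]\big|\ge\delta_1+\delta_2\Big)\le\hat C(\epsilon,\delta_2,\delta_1)\,e^{-N\hat\beta(\epsilon,\delta_2,\delta_1)}.$$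
   Context: A kernel $k:\mathcal X\times\mathcal X\to\mathbb R$ with RKHS $\mathcal H$ is universal if for every compact $\hat{\mathcal X}\subseteq\mathcal X$, every continuous $f\in\mathcal C(\hat{\mathcal X})$ and every $\epsilon>0$ there is $\hat f\in\mathcal H$ with $\sup_{x\in\hat{\mathcal X}}|\hat f(x)-f(x)|\le\epsilon$. $\mathcal C(\mathcal X)$ denotes the continuous real functions on $\mathcal X$. $\|f\|_{\mathcal H^d}=\big(\sum_{t=1}^d\|f^{(t)}\|_{\mathcal H}^2\big)^{1/2}$, where $f^{(t)}$ is the $t$-th component of $f$. "Prob" is the infinite product probability measure of $P$, i.e. the law of the i.i.d. sample sequence. Notations like $\hat C(\epsilon,\delta_2,\delta_1)$ merely record what the constants depend on. The "min" in $\vartheta_N$ denotes the optimal value. *)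

theory Defs
  imports "HOL-Probability.Probability"
begin

text \<open>
  A reproducing kernel Hilbert space on \<open>X\<close> with kernel \<open>k\<close>: the Hilbert space is a type \<open>'h\<close>,
  and \<open>evf f\<close> is the function on \<open>X\<close> that \<open>f\<close> stands for. By the first axiom elements of \<open>'h\<close> are
  identified with functions on \<open>X\<close>; values of \<open>evf f\<close> outside \<open>X\<close> carry no meaning.
  The element \<open>ksec x\<close> is the kernel section \<open>k(\<cdot>, x)\<close>. Linearity of \<open>evf\<close> on \<open>X\<close>, and symmetry
  and positive semidefiniteness of \<open>k\<close> on \<open>X\<close>, follow from the axioms.
\<close>

locale rkhs =
  fixes X :: "'a set"
    and k :: "'a \<Rightarrow> 'a \<Rightarrow> real"
    and evf :: "'h::{real_inner, complete_space} \<Rightarrow> 'a \<Rightarrow> real"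
    and ksec :: "'a \<Rightarrow> 'h"
  assumes eval_inject: "(\<And>x. x \<in> X \<Longrightarrow> evf f x = evf g x) \<Longrightarrow> f = g"
    and eval_section: "x \<in> X \<Longrightarrow> x' \<in> X \<Longrightarrow> evf (ksec x) x' = k x' x"
    and reproducing: "x \<in> X \<Longrightarrow> evf f x = f \<bullet> ksec x"

definition universal_rkhs ::
    "'a::topological_space set \<Rightarrow> ('h \<Rightarrow> 'a \<Rightarrow> real) \<Rightarrow> bool" where
  "universal_rkhs X evf \<longleftrightarrow>
     (\<forall>K f \<epsilon>. compact K \<longrightarrow> K \<subseteq> X \<longrightarrow> continuous_on K f \<longrightarrow> \<epsilon> > 0 \<longrightarrow>
        (\<exists>g. \<forall>x\<in>K. \<bar>evf g x - f x\<bar> \<le> \<epsilon>))"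

text \<open>
  The product of finitely many copies of \<open>'h\<close> is the type \<open>'h ^ 'n\<close>; its library norm is
  \<open>(\<Sum>t. \<parallel>f $ t\<parallel>\<^sup>2)\<close> to the power one half (see \<open>norm_vec_def\<close>, \<open>L2_set_def\<close>).
\<close>

definition vec_eval :: "('h \<Rightarrow> 'a \<Rightarrow> real) \<Rightarrow> 'h ^ 'n \<Rightarrow> 'a \<Rightarrow> real ^ 'n" where
  "vec_eval evf f x = (\<chi> t. evf (f $ t) x)"

definition expected_cost ::
    "('a \<times> 'b) measure \<Rightarrow> ('c \<Rightarrow> real \<Rightarrow> 'b \<Rightarrow> real) \<Rightarrow> ('a \<Rightarrow> 'c) \<Rightarrow> ('a \<Rightarrow> real) \<Rightarrow> real" where
  "expected_cost Q h z s = (\<integral>(x, y). h (z x) (s x) y \<partial>Q)"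

definition optimal_solution ::
    "'a::topological_space set \<Rightarrow> ('a \<times> 'b) measure \<Rightarrow>
     ('c::topological_space \<Rightarrow> real \<Rightarrow> 'b \<Rightarrow> real) \<Rightarrow> ('a \<Rightarrow> 'c) \<Rightarrow> ('a \<Rightarrow> real) \<Rightarrow> bool" where
  "optimal_solution X P h z s \<longleftrightarrow>
     continuous_on X z \<and> continuous_on X s \<and>
     (\<forall>z' s'. continuous_on X z' \<longrightarrow> continuous_on X s' \<longrightarrow>
        expected_cost P h z s \<le> expected_cost P h z' s')"

text \<open>
  The average of the point masses at the first \<open>N\<close> samples, meaningful for \<open>N > 0\<close>.
  Samples are indexed from 0.
\<close>

definition empirical_measure :: "(nat \<Rightarrow> 'a) \<Rightarrow> nat \<Rightarrow> 'a measure" where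
  "empirical_measure \<omega> N = measure_pmf (map_pmf \<omega> (pmf_of_set {..<N}))"

lemma integral_empirical_measure:
  fixes f :: "'a \<Rightarrow> real"
  assumes "N > 0"
  shows "(\<integral>p. f p \<partial>empirical_measure \<omega> N) = (\<Sum>i<N. f (\<omega> i)) / N"
  using assms by (simp add: empirical_measure_def integral_pmf_of_set lessThan_empty_iff)

text \<open>
  Optimal value of the regularized problem over the closed balls of radius \<open>\<beta>\<^sub>1\<close> and \<open>\<beta>\<^sub>2\<close>,
  as an infimum; attainment is not part of the definition.
\<close>

definition reg_value ::
    "('h::real_inner \<Rightarrow> 'a \<Rightarrow> real) \<Rightarrow> (real ^ 'n \<Rightarrow> real \<Rightarrow> 'b \<Rightarrow> real) \<Rightarrow> real \<Rightarrow> real \<Rightarrow>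
     ('a \<times> 'b) measure \<Rightarrow> real \<Rightarrow> real" where
  "reg_value evf h \<beta>1 \<beta>2 Q lam =
     (INF (z, s) \<in> cball (0 :: 'h ^ 'n) \<beta>1 \<times> cball 0 \<beta>2.
        expected_cost Q h (vec_eval evf z) (evf s) + lam * ((norm z)\<^sup>2 + (norm s)\<^sup>2))"

end

theory Submission imports Defs
begin

text \<open>
  Every \<open>f\<close> in an RKHS with continuous kernel satisfies \<open>\<bar>f x - f x'\<bar> \<le> \<parallel>f\<parallel> \<parallel>k(\<cdot>, x) - k(\<cdot>, x')\<parallel>\<close>, and
  \<open>x \<mapsto> k(\<cdot>, x)\<close> is continuous. So the costs \<open>(x, y) \<mapsto> h (z x) (s x) y\<close>, with \<open>(z, s)\<close> in a bounded
  set, form a bounded equicontinuous family on the compact set \<open>X \<times> Y\<close>. On the cells of one fine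
  finite Borel partition all of them are nearly constant, so their empirical means are uniformly
  close to their expectations as soon as the empirical frequencies of the finitely many cells are
  close to the cell probabilities; Hoeffding's inequality and a union bound give the exponential
  rate. The penalty is at most \<open>\<epsilon>\<close>, which costs only another \<open>\<epsilon>\<close> in the optimal value. Part (i) is
  uniform approximation by universality together with uniform continuity of \<open>h\<close> on compact sets.
\<close>

section \<open>Hoeffding's inequality and uniform deviation over an equicontinuous family\<close>

text \<open>Under the product measure the coordinates are independent with law \<open>M\<close>, so
  the i.i.d. form of Hoeffding's inequality applies to \<open>f\<close> of the coordinates. Its
  later use is with \<open>f\<close> the indicator of a cell, where the mean is an empirical
  frequency.\<close>

lemma (in prob_space) PiM_Hoeffding_abs_ge:
  fixes f :: "'a \<Rightarrow> real"
  assumes f [measurable]: "f \<in> borel_measurable M"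
    and range: "\<And>x. x \<in> space M \<Longrightarrow> f x \<in> {a..b}"
    and ab: "a < b" and N: "N > 0" and \<epsilon>: "\<epsilon> \<ge> 0"
  shows "\<P>(\<omega> in PiM (UNIV :: nat set) (\<lambda>_. M). \<bar>(\<Sum>i<N. f (\<omega> i)) / N - expectation f\<bar> \<ge> \<epsilon>)
    \<le> 2 * exp (- 2 * real N * \<epsilon>\<^sup>2 / (b - a)\<^sup>2)"
proof -
  let ?M = "PiM (UNIV :: nat set) (\<lambda>_. M)"
  interpret P: product_prob_space "\<lambda>_. M" "UNIV :: nat set"
    by unfold_locales
  have distr_component: "distr ?M M (\<lambda>\<omega>. \<omega> i) = M" for i
    by (rule distr_PiM_component) (auto simp: prob_space_axioms)
  \<comment> \<open>The joint law of the coordinates is the product measure itself, and by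
    \<open>distr_component\<close> this is also the product of their marginal laws.\<close>
  have "P.indep_vars (\<lambda>_. M) (\<lambda>i \<omega>. \<omega> i) UNIV"
    by (subst P.indep_vars_iff_distr_eq_PiM') (auto simp: distr_component distr_id restrict_UNIV)
  then have "P.indep_vars (\<lambda>_. borel) (\<lambda>i \<omega>. f (\<omega> i)) UNIV"
    by (rule P.indep_vars_compose2) simp
  then have indep: "P.indep_vars (\<lambda>_. borel) (\<lambda>i \<omega>. f (\<omega> i)) {..<N}"
    by (rule P.indep_vars_subset) simp
  have distr_f: "distr ?M borel (\<lambda>\<omega>. f (\<omega> i)) = distr M borel f" for i
    using distr_distr[of f M borel "\<lambda>\<omega>. \<omega> i" ?M] by (simp add: distr_component o_def)
  interpret H: Hoeffding_ineq_iid ?M "{..<N}" "\<lambda>i \<omega>. f (\<omega> i)" "\<lambda>\<omega>. f (\<omega> 0)" a b "expectation f"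
  proof unfold_locales
    show "AE \<omega> in ?M. f (\<omega> 0) \<in> {a..b}"
      using range by (intro AE_I2) (auto simp: space_PiM PiE_iff)
    have "expectation f = (\<integral>x. x \<partial>distr M borel f)"
      by (simp add: integral_distr)
    also have "\<dots> = P.expectation (\<lambda>\<omega>. f (\<omega> 0))"
      by (subst distr_f[of 0, symmetric]) (simp add: integral_distr)
    finally show "expectation f \<equiv> P.expectation (\<lambda>\<omega>. f (\<omega> 0))" by simp
  qed (auto simp: indep distr_f)
  show ?thesis
    using H.Hoeffding_ineq_abs_ge'[OF \<epsilon> ab] N by (simp add: lessThan_empty_iff)
qed

text \<open>Compactness gives a finite cover by balls of radius \<open>d\<close>; removing from each
  ball the earlier ones makes the cells disjoint and leaves the union unchanged. The centres lie in
  \<open>K\<close>, so that functions controlled only on \<open>K\<close> can be evaluated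
  there.\<close>

lemma compact_finite_borel_partition:
  fixes K :: "'a::metric_space set"
  assumes K: "compact K" and d: "d > 0"
  obtains n and c :: "nat \<Rightarrow> 'a" and A where
    "\<And>i. i < n \<Longrightarrow> c i \<in> K" "\<And>i. A i \<in> sets borel" "disjoint_family A"
    "K \<subseteq> (\<Union>i<n. A i)" "\<And>i. A i \<subseteq> ball (c i) d"
proof -
  obtain C where C: "C \<subseteq> K" "finite C" "K \<subseteq> (\<Union>x\<in>C. ball x d)"
    using compactE_image[OF K, of K "\<lambda>x. ball x d"] d by (metis UN_I centre_in_ball open_ball subsetI)
  obtain n and c :: "nat \<Rightarrow> 'a" where c: "C = c ` {..<n}"
    using C(2) by (auto dest!: finite_imp_nat_seg_image_inj_on simp: lessThan_def)
  show thesis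
  proof
    let ?A = "disjointed (\<lambda>i. ball (c i) d)"
    show "c i \<in> K" if "i < n" for i using that c C by auto
    show "?A i \<in> sets borel" for i by (auto simp: disjointed_def)
    show "K \<subseteq> (\<Union>i<n. ?A i)"
      using C(3) by (simp add: c lessThan_atLeast0 finite_UN_disjointed_eq)
    show "?A i \<subseteq> ball (c i) d" for i by (rule disjointed_subset)
  qed (rule disjoint_family_disjointed)
qed

text \<open>One exceptional event serves all of \<open>F\<close>: it constrains only the frequencies
  of finitely many cells, so it is measurable and its probability does not depend on how large
  \<open>F\<close> is. Stating the bound through \<open>E\<close> avoids the question whether a
  supremum over \<open>F\<close> is measurable. The error is split into thirds: passing to a step
  function in the empirical mean, passing to it in the expectation, and the deviation of the step
  function.\<close>

lemma equicontinuous_uniform_deviation: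
  fixes M :: "'a::metric_space measure" and F :: "('a \<Rightarrow> real) set"
  assumes "prob_space M" and sets_M: "sets M = sets (restrict_space borel K)" and K: "compact K"
    and equicont: "\<And>e. e > 0 \<Longrightarrow>
      \<exists>d>0. \<forall>f\<in>F. \<forall>p\<in>K. \<forall>q\<in>K. dist p q < d \<longrightarrow> \<bar>f p - f q\<bar> \<le> e"
    and bounded: "\<And>f p. f \<in> F \<Longrightarrow> p \<in> K \<Longrightarrow> \<bar>f p\<bar> \<le> B"
    and F_meas: "\<And>f. f \<in> F \<Longrightarrow> f \<in> borel_measurable M"
    and e: "e > 0"
  obtains C \<beta> where "C > 0" "\<beta> > 0"
    "\<And>N. N > 0 \<Longrightarrow> \<exists>E \<in> sets (PiM (UNIV :: nat set) (\<lambda>_. M)).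
       measure (PiM UNIV (\<lambda>_. M)) E \<le> C * exp (- real N * \<beta>) \<and>
       (\<forall>\<omega> \<in> space (PiM UNIV (\<lambda>_. M)) - E. \<forall>f\<in>F.
          \<bar>(\<Sum>i<N. f (\<omega> i)) / N - (\<integral>p. f p \<partial>M)\<bar> \<le> e)"
proof -
  interpret prob_space M by fact
  let ?M = "PiM (UNIV :: nat set) (\<lambda>_. M)"
  interpret P: product_prob_space "\<lambda>_. M" "UNIV :: nat set"
    by unfold_locales
  have space_M: "space M = K"
    using sets_eq_imp_space_eq[OF sets_M] by (simp add: space_restrict_space)
  have e3: "e / 3 > 0" using e by simp
  obtain d where d: "d > 0"
    and Fd: "\<And>f p q. f \<in> F \<Longrightarrow> p \<in> K \<Longrightarrow> q \<in> K \<Longrightarrow> dist p q < d \<Longrightarrow> \<bar>f p - f q\<bar> \<le> e / 3"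
    using equicont[OF e3] by blast
  obtain n and c :: "nat \<Rightarrow> 'a" and A where c: "\<And>i. i < n \<Longrightarrow> c i \<in> K" and A_borel: "\<And>i. A i \<in> sets borel"
    and disj: "disjoint_family A" and cover: "K \<subseteq> (\<Union>i<n. A i)"
    and A_ball: "\<And>i. A i \<subseteq> ball (c i) d"
    using compact_finite_borel_partition[OF K d] by blast
  define I where "I j = (indicator (A j) :: 'a \<Rightarrow> real)" for j
  have I_meas [measurable]: "I j \<in> borel_measurable M" for j
  proof -
    have "I j \<in> borel_measurable (restrict_space borel K)"
      unfolding I_def by (intro measurable_restrict_space1 borel_measurable_indicator A_borel)
    then show ?thesis using measurable_cong_sets[OF sets_M refl] by blast
  qed
  have I_int [simp]: "integrable M (I j)" for j
    by (rule integrable_const_bound[where B = 1]) (simp_all, simp add: I_def indicator_def)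
  \<comment> \<open>The step function takes on each cell the value of \<open>f\<close> at the
    centre. Only the coefficients depend on \<open>f\<close>; the indicators are common to the whole
    family.\<close>
  define g where "g f = (\<lambda>p. \<Sum>j<n. f (c j) * I j p)" for f
  have g_close: "\<bar>f p - g f p\<bar> \<le> e / 3" if f: "f \<in> F" and p: "p \<in> K" for f p
  proof -
    obtain j where j: "j < n" "p \<in> A j" using cover p by auto
    have I_eq: "I i p = (if i = j then 1 else 0)" for i
      using j(2) disjoint_family_onD[OF disj, of i j] by (auto simp: I_def indicator_def)
    have "g f p = f (c j)"
      unfolding g_def I_eq using j(1) by (simp add: if_distrib cong: if_cong)
    moreover have "\<bar>f p - f (c j)\<bar> \<le> e / 3"
      using j A_ball[of j] by (intro Fd f p c) (auto simp: dist_commute)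
    ultimately show ?thesis by simp
  qed
  \<comment> \<open>Chosen so that \<open>n\<close> cells with coefficients at most
    \<open>\<bar>B\<bar>\<close> contribute no more than a third of \<open>e\<close>. The
    \<open>+ 1\<close> keeps the denominator positive; the absolute value covers a negative
    \<open>B\<close>, possible when \<open>F\<close> is empty.\<close>
  define \<eta> where "\<eta> = e / (3 * (n * \<bar>B\<bar> + 1))"
  have \<eta>: "\<eta> > 0" "n * \<bar>B\<bar> * \<eta> \<le> e / 3"
  proof -
    have pos: "n * \<bar>B\<bar> + 1 > 0" by (simp add: add_nonneg_pos)
    then show "\<eta> > 0" unfolding \<eta>_def using e by simp
    show "n * \<bar>B\<bar> * \<eta> \<le> e / 3" unfolding \<eta>_def using e pos by (simp add: field_simps)
  qed
  define bad where "bad N j =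
    {\<omega> \<in> space ?M. \<eta> \<le> \<bar>(\<Sum>i<N. I j (\<omega> i)) / real N - (\<integral>p. I j p \<partial>M)\<bar>}" for N :: nat and j
  have bad_sets: "bad N j \<in> sets ?M" for N j
    unfolding bad_def by measurable
  show thesis
  proof
    \<comment> \<open>The union bound gives \<open>2 * n\<close> times the Hoeffding term for the
      range from 0 to 1; the added 1 makes the constant positive for every \<open>n\<close>.\<close>
    show "2 * real n + 1 > 0" "2 * \<eta>\<^sup>2 > 0" using \<eta> by simp_all
    fix N :: nat assume N: "N > 0"
    let ?E = "\<Union>j<n. bad N j"
    have "measure ?M ?E \<le> (\<Sum>j<n. measure ?M (bad N j))"
      by (rule P.finite_measure_subadditive_finite) (use bad_sets in auto)
    also have "\<dots> \<le> (\<Sum>j<n. 2 * exp (- 2 * real N * \<eta>\<^sup>2 / (1 - 0)\<^sup>2))"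
    proof (rule sum_mono)
      show "measure ?M (bad N j) \<le> 2 * exp (- 2 * real N * \<eta>\<^sup>2 / (1 - 0)\<^sup>2)" for j
        unfolding bad_def
        using \<eta> N by (intro PiM_Hoeffding_abs_ge[where f = "I j"]) (simp_all, simp add: I_def indicator_def)
    qed
    also have "\<dots> \<le> (2 * real n + 1) * exp (- real N * (2 * \<eta>\<^sup>2))"
      by (simp add: mult_ac algebra_simps)
    finally have prob_E: "measure ?M ?E \<le> (2 * real n + 1) * exp (- real N * (2 * \<eta>\<^sup>2))" .
    have "\<bar>(\<Sum>i<N. f (\<omega> i)) / N - (\<integral>p. f p \<partial>M)\<bar> \<le> e"
      if \<omega>: "\<omega> \<in> space ?M - ?E" and f: "f \<in> F" for \<omega> f
    proof -
      have \<omega>_K: "\<omega> i \<in> K" for i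
        using \<omega> by (auto simp: space_PiM space_M PiE_iff)
      define D where "D j = (\<Sum>i<N. I j (\<omega> i)) / real N - (\<integral>p. I j p \<partial>M)" for j
      have D: "\<bar>D j\<bar> \<le> \<eta>" if "j < n" for j
        using \<omega> that by (force simp: bad_def D_def)
      have f_int: "integrable M f"
        using bounded[OF f] F_meas[OF f]
        by (intro integrable_const_bound[where B = B]) (auto simp: space_M)
      have g_int: "integrable M (g f)" unfolding g_def by simp
      have "\<bar>(\<Sum>i<N. f (\<omega> i)) - (\<Sum>i<N. g f (\<omega> i))\<bar> \<le> (\<Sum>i<N. \<bar>f (\<omega> i) - g f (\<omega> i)\<bar>)"
        unfolding sum_subtractf[symmetric] by (rule sum_abs)
      also have "\<dots> \<le> (\<Sum>i<N. e / 3)"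
        by (intro sum_mono g_close f \<omega>_K)
      finally have "\<bar>(\<Sum>i<N. f (\<omega> i)) / N - (\<Sum>i<N. g f (\<omega> i)) / N\<bar> \<le> e / 3"
        using N by (simp add: diff_divide_distrib[symmetric] field_simps)
      moreover have "\<bar>(\<integral>p. f p \<partial>M) - (\<integral>p. g f p \<partial>M)\<bar> \<le> e / 3"
      proof -
        have "\<bar>\<integral>p. f p - g f p \<partial>M\<bar> \<le> (\<integral>p. \<bar>f p - g f p\<bar> \<partial>M)"
          by (rule integral_abs_bound)
        also have "\<dots> \<le> (\<integral>p. e / 3 \<partial>M)"
          using f_int g_int g_close[OF f] by (intro integral_mono) (auto simp: space_M)
        finally show ?thesis using f_int g_int by (simp add: prob_space)
      qed
      moreover have "\<bar>(\<Sum>i<N. g f (\<omega> i)) / N - (\<integral>p. g f p \<partial>M)\<bar> \<le> e / 3"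
      proof -
        \<comment> \<open>Mean and expectation are linear, so the deviation of the step function is
          the combination of the cell deviations \<open>D j\<close> with coefficients
          \<open>f (c j)\<close>.\<close>
        have "(\<Sum>i<N. g f (\<omega> i)) / N - (\<integral>p. g f p \<partial>M) = (\<Sum>j<n. f (c j) * D j)"
          unfolding g_def D_def
          by (subst sum.swap)
             (simp add: sum_divide_distrib sum_subtractf right_diff_distrib sum_distrib_left)
        also have "\<bar>\<dots>\<bar> \<le> (\<Sum>j<n. \<bar>f (c j) * D j\<bar>)" by (rule sum_abs)
        also have "\<dots> \<le> (\<Sum>j<n. \<bar>B\<bar> * \<eta>)"
          unfolding abs_mult
          using bounded[OF f c] D by (intro sum_mono mult_mono) (force intro: order_trans)+
        also have "\<dots> \<le> e / 3" using \<eta>(2) by simp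
        finally show ?thesis .
      qed
      ultimately show ?thesis by linarith
    qed
    with prob_E bad_sets show "\<exists>E \<in> sets ?M.
       measure ?M E \<le> (2 * real n + 1) * exp (- real N * (2 * \<eta>\<^sup>2)) \<and>
       (\<forall>\<omega> \<in> space ?M - E. \<forall>f\<in>F. \<bar>(\<Sum>i<N. f (\<omega> i)) / N - (\<integral>p. f p \<partial>M)\<bar> \<le> e)"
      by (intro bexI[of _ ?E]) auto
  qed
qed

section \<open>Integrability and continuity of the cost on compact sets\<close>

lemma integrable_continuous_on_compact:
  fixes f :: "'a::metric_space \<Rightarrow> real"
  assumes "finite_measure M" and sets_M: "sets M = sets (restrict_space borel K)"
    and K: "compact K" and f: "continuous_on K f"
  shows "integrable M f"
proof -
  interpret finite_measure M by fact
  have space_M: "space M = K"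
    using sets_eq_imp_space_eq[OF sets_M] by (simp add: space_restrict_space)
  have "bounded (f ` K)"
    by (intro compact_imp_bounded compact_continuous_image f K)
  then obtain B where B: "\<And>p. p \<in> K \<Longrightarrow> norm (f p) \<le> B"
    by (auto simp: bounded_iff)
  have "f \<in> borel_measurable M"
    using borel_measurable_continuous_on_restrict[OF f] measurable_cong_sets[OF sets_M refl] by blast
  then show ?thesis
    using B by (intro integrable_const_bound[where B = B]) (auto simp: space_M)
qed

lemma continuous_on_cost:
  fixes h :: "'c::topological_space \<Rightarrow> real \<Rightarrow> 'b::topological_space \<Rightarrow> real"
  assumes h: "continuous_on UNIV (\<lambda>(z, s, y). h z s y)"
    and z: "continuous_on X z" and s: "continuous_on X s"
  shows "continuous_on (X \<times> Y) (\<lambda>(x, y). h (z x) (s x) y)"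
proof -
  have "continuous_on (X \<times> Y) (\<lambda>p. (z (fst p), s (fst p), snd p))"
    by (intro continuous_intros continuous_on_compose2[OF z] continuous_on_compose2[OF s]) auto
  from continuous_on_compose2[OF h this] show ?thesis
    by (simp add: case_prod_unfold)
qed

text \<open>Heine-Cantor on the product of two closed balls with \<open>Y\<close>. Closeness is
  measured by the sum of the three distances, which dominates the product metric, because later
  estimates control each argument separately.\<close>

lemma cost_uniformly_continuous:
  fixes h :: "'c::euclidean_space \<Rightarrow> real \<Rightarrow> 'b::metric_space \<Rightarrow> real"
  assumes h: "continuous_on UNIV (\<lambda>(z, s, y). h z s y)" and Y: "compact Y" and e: "e > 0"
  obtains d where "d > 0"
    "\<And>z z' s s' y y'. \<lbrakk>norm z \<le> R; norm z' \<le> R; \<bar>s\<bar> \<le> R; \<bar>s'\<bar> \<le> R; y \<in> Y; y' \<in> Y;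
       dist z z' + dist s s' + dist y y' < d\<rbrakk> \<Longrightarrow> \<bar>h z s y - h z' s' y'\<bar> \<le> e"
proof -
  let ?D = "cball (0 :: 'c) R \<times> cball (0 :: real) R \<times> Y"
  have "uniformly_continuous_on ?D (\<lambda>(z, s, y). h z s y)"
    by (intro compact_uniformly_continuous continuous_on_subset[OF h] compact_Times compact_cball Y) auto
  then obtain d where d: "d > 0"
    and hd: "\<And>u v. u \<in> ?D \<Longrightarrow> v \<in> ?D \<Longrightarrow> dist u v < d \<Longrightarrow>
      dist ((\<lambda>(z, s, y). h z s y) u) ((\<lambda>(z, s, y). h z s y) v) < e"
    using e unfolding uniformly_continuous_on_def by (metis (no_types, lifting) dist_commute)
  show thesis
  proof
    fix z z' s s' y y'
    assume *: "norm (z :: 'c) \<le> R" "norm z' \<le> R" "\<bar>s\<bar> \<le> R" "\<bar>s'\<bar> \<le> R" "y \<in> Y" "y' \<in> Y"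
      and close: "dist z z' + dist s s' + dist y y' < d"
    have "dist (z, s, y) (z', s', y') \<le> dist z z' + dist (s, y) (s', y')"
      by (simp add: dist_Pair_Pair[of z] sqrt_sum_squares_le_sum)
    also have "dist (s, y) (s', y') \<le> dist s s' + dist y y'"
      by (simp add: dist_Pair_Pair sqrt_sum_squares_le_sum)
    finally have "dist (z, s, y) (z', s', y') < d" using close by simp
    then show "\<bar>h z s y - h z' s' y'\<bar> \<le> e"
      using hd[of "(z, s, y)" "(z', s', y')"] * by (simp add: dist_real_def)
  qed (rule d)
qed

section \<open>Value and increment bounds from the reproducing property\<close>

text \<open>Cauchy-Schwarz in each component, with the common factor \<open>norm v\<close> taken out
  of the Euclidean norm. With \<open>v\<close> a kernel section or a difference of two, it bounds
  values and increments of vector-valued RKHS functions.\<close>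

lemma norm_vec_inner_le:
  fixes z :: "'h::real_inner ^ 'n"
  shows "norm (\<chi> t. (z $ t) \<bullet> v) \<le> norm z * norm v"
proof -
  have "norm (\<chi> t. (z $ t) \<bullet> v) \<le> L2_set (\<lambda>t. norm (z $ t) * norm v) UNIV"
    unfolding norm_vec_def by (intro L2_set_mono) (auto simp: Cauchy_Schwarz_ineq2)
  also have "\<dots> = norm z * norm v"
    by (simp add: norm_vec_def L2_set_left_distrib)
  finally show ?thesis .
qed

context rkhs
begin

lemma inner_ksec: "x \<in> X \<Longrightarrow> x' \<in> X \<Longrightarrow> ksec x \<bullet> ksec x' = k x' x"
  using reproducing eval_section by metis

lemma vec_eval_eq: "x \<in> X \<Longrightarrow> vec_eval evf z x = (\<chi> t. (z $ t) \<bullet> ksec x)"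
  by (simp add: vec_eval_def reproducing)

lemma norm_vec_eval_le: "x \<in> X \<Longrightarrow> norm (vec_eval evf z x) \<le> norm z * norm (ksec x)"
  by (simp add: vec_eval_eq norm_vec_inner_le)

lemma dist_vec_eval_le:
  assumes "x \<in> X" "x' \<in> X"
  shows "dist (vec_eval evf z x) (vec_eval evf z x') \<le> norm z * dist (ksec x) (ksec x')"
proof -
  have "vec_eval evf z x - vec_eval evf z x' = (\<chi> t. (z $ t) \<bullet> (ksec x - ksec x'))"
    using assms by (simp add: vec_eval_eq vec_eq_iff inner_diff_right)
  then show ?thesis by (simp add: dist_norm norm_vec_inner_le)
qed

lemma abs_evf_le: "x \<in> X \<Longrightarrow> \<bar>evf f x\<bar> \<le> norm f * norm (ksec x)"
  by (simp add: reproducing Cauchy_Schwarz_ineq2)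

lemma dist_evf_le:
  assumes "x \<in> X" "x' \<in> X"
  shows "dist (evf f x) (evf f x') \<le> norm f * dist (ksec x) (ksec x')"
  using assms Cauchy_Schwarz_ineq2[of f "ksec x - ksec x'"]
  by (simp add: reproducing dist_norm inner_diff_right)

end

section \<open>Continuous kernels: equicontinuity and bounds on norm balls\<close>

locale continuous_rkhs = rkhs X k evf ksec
  for X :: "'a::metric_space set" and k and evf :: "'h::{real_inner, complete_space} \<Rightarrow> 'a \<Rightarrow> real"
    and ksec +
  assumes continuous_kernel: "continuous_on (X \<times> X) (\<lambda>(x, x'). k x x')"
begin

text \<open>By the reproducing property the squared distance of two sections is
  \<open>k x' x' - k x' x - k x x' + k x x\<close>, which tends to 0 by continuity of the
  kernel.\<close>

lemma continuous_on_ksec: "continuous_on X ksec"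
  unfolding continuous_on
proof
  fix x assume x: "x \<in> X"
  \<comment> \<open>Taking \<open>u\<close> and \<open>v\<close> as identity or constant covers the
    three varying terms of the expansion at once.\<close>
  have k_lim: "((\<lambda>x'. k (u x') (v x')) \<longlongrightarrow> k x x) (at x within X)"
    if "u \<in> {\<lambda>x'. x', \<lambda>x'. x}" "v \<in> {\<lambda>x'. x', \<lambda>x'. x}" for u v
  proof -
    have "continuous_on X (\<lambda>x'. (u x', v x'))"
      using that by (auto intro!: continuous_intros)
    then have "continuous_on X (\<lambda>x'. (\<lambda>(x, x'). k x x') (u x', v x'))"
      by (rule continuous_on_compose2[OF continuous_kernel]) (use x that in auto)
    then show ?thesis using x that unfolding continuous_on by force
  qed
  have "((\<lambda>x'. k x' x' - k x' x - k x x' + k x x) \<longlongrightarrow> k x x - k x x - k x x + k x x) (at x within X)"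
    by (intro tendsto_intros k_lim[of "\<lambda>x'. x'" "\<lambda>x'. x'"] k_lim[of "\<lambda>x'. x'" "\<lambda>x'. x"]
        k_lim[of "\<lambda>x'. x" "\<lambda>x'. x'"]) auto
  from tendsto_real_sqrt[OF this]
  have "((\<lambda>x'. sqrt (k x' x' - k x' x - k x x' + k x x)) \<longlongrightarrow> 0) (at x within X)"
    by simp
  moreover have "\<forall>\<^sub>F x' in at x within X. sqrt (k x' x' - k x' x - k x x' + k x x) = dist (ksec x') (ksec x)"
    by (auto simp: eventually_at_filter dist_norm norm_eq_sqrt_inner inner_diff_left inner_diff_right
        inner_ksec x algebra_simps)
  ultimately have "((\<lambda>x'. dist (ksec x') (ksec x)) \<longlongrightarrow> 0) (at x within X)"
    using tendsto_cong by fast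
  then show "(ksec \<longlongrightarrow> ksec x) (at x within X)"
    by (rule tendsto_dist_iff[THEN iffD2])
qed

lemma continuous_on_evf: "continuous_on X (evf f)"
proof -
  have "continuous_on X (\<lambda>x. f \<bullet> ksec x)"
    by (intro continuous_intros continuous_on_ksec)
  then show ?thesis by (rule continuous_on_eq) (simp add: reproducing)
qed

lemma continuous_on_vec_eval: "continuous_on X (vec_eval evf z)"
  unfolding vec_eval_def by (intro continuous_intros continuous_on_evf)

lemma ksec_bounded:
  assumes "compact X"
  obtains R where "R \<ge> 0" "\<And>x. x \<in> X \<Longrightarrow> norm (ksec x) \<le> R"
proof -
  have "bounded (ksec ` X)"
    by (intro compact_imp_bounded compact_continuous_image continuous_on_ksec assms)
  then obtain R where "\<And>x. x \<in> X \<Longrightarrow> norm (ksec x) \<le> R" by (auto simp: bounded_iff)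
  then have "\<And>x. x \<in> X \<Longrightarrow> norm (ksec x) \<le> \<bar>R\<bar>" by force
  then show thesis by (intro that[of "\<bar>R\<bar>"]) simp_all
qed

text \<open>A value at \<open>x\<close> is at most the norm of the function times that of the
  section at \<open>x\<close>, and sections are bounded on compact \<open>X\<close>. A common radius
  places both function arguments of \<open>h\<close> in fixed balls.\<close>

lemma ball_values_bounded:
  assumes "compact X"
  obtains R where
    "\<And>z :: 'h ^ 'n. \<And>x. norm z \<le> \<beta>1 \<Longrightarrow> x \<in> X \<Longrightarrow> norm (vec_eval evf z x) \<le> R"
    "\<And>s x. norm s \<le> \<beta>2 \<Longrightarrow> x \<in> X \<Longrightarrow> \<bar>evf s x\<bar> \<le> R"
proof -
  obtain R where R: "R \<ge> 0" "\<And>x. x \<in> X \<Longrightarrow> norm (ksec x) \<le> R"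
    by (rule ksec_bounded[OF assms]) blast
  have le: "a * norm (ksec x) \<le> max \<beta>1 \<beta>2 * R" if "x \<in> X" "0 \<le> a" "a \<le> max \<beta>1 \<beta>2" for a x
    using that R by (intro mult_mono) auto
  show thesis
  proof
    show "norm (vec_eval evf z x) \<le> max \<beta>1 \<beta>2 * R" if "norm z \<le> \<beta>1" "x \<in> X" for z :: "'h ^ 'n" and x
      using norm_vec_eval_le[of x z] le[of x "norm z"] that by fastforce
    show "\<bar>evf s x\<bar> \<le> max \<beta>1 \<beta>2 * R" if "norm s \<le> \<beta>2" "x \<in> X" for s x
      using abs_evf_le[of x s] le[of x "norm s"] that by fastforce
  qed
qed

text \<open>Increments of an RKHS function are at most its norm times the distance of the kernel
  sections, so a norm ball inherits one modulus of continuity from \<open>ksec\<close>. Uniform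
  continuity of \<open>h\<close> carries it over to the cost.\<close>

lemma cost_equicontinuous:
  fixes h :: "real ^ 'n \<Rightarrow> real \<Rightarrow> 'b::metric_space \<Rightarrow> real"
  assumes X: "compact X" and Y: "compact Y"
    and h: "continuous_on UNIV (\<lambda>(z, s, y). h z s y)" and e: "e > 0"
  shows "\<exists>d>0. \<forall>z \<in> cball (0 :: 'h ^ 'n) \<beta>1. \<forall>s \<in> cball (0 :: 'h) \<beta>2. \<forall>x\<in>X. \<forall>y\<in>Y. \<forall>x'\<in>X. \<forall>y'\<in>Y.
    dist (x, y) (x', y') < d \<longrightarrow>
    \<bar>h (vec_eval evf z x) (evf s x) y - h (vec_eval evf z x') (evf s x') y'\<bar> \<le> e"
proof -
  obtain R where Rz: "\<And>z :: 'h ^ 'n. \<And>x. norm z \<le> \<beta>1 \<Longrightarrow> x \<in> X \<Longrightarrow> norm (vec_eval evf z x) \<le> R"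
    and Rs: "\<And>s x. norm s \<le> \<beta>2 \<Longrightarrow> x \<in> X \<Longrightarrow> \<bar>evf s x\<bar> \<le> R"
    by (rule ball_values_bounded[OF X]) blast
  obtain d where d: "d > 0" and hd: "\<And>z z' s s' y y'. \<lbrakk>norm z \<le> R; norm z' \<le> R; \<bar>s\<bar> \<le> R; \<bar>s'\<bar> \<le> R;
      y \<in> Y; y' \<in> Y; dist z z' + dist s s' + dist y y' < d\<rbrakk> \<Longrightarrow> \<bar>h z s y - h z' s' y'\<bar> \<le> e"
    by (rule cost_uniformly_continuous[OF h Y e]) blast
  \<comment> \<open>Bounds the sum of the norms of \<open>z\<close> and \<open>s\<close>; the maxima
    allow negative radii, and the \<open>+ 1\<close> permits division by \<open>m\<close>.\<close>
  define m where "m = max 0 \<beta>1 + max 0 \<beta>2 + 1"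
  have m: "m > 0" by (simp add: m_def add_nonneg_pos)
  have "uniformly_continuous_on X ksec"
    by (intro compact_uniformly_continuous continuous_on_ksec X)
  \<comment> \<open>Half of \<open>d\<close> is spent on the two function values, the other half is
    left for \<open>y\<close>.\<close>
  then obtain d' where d': "d' > 0"
    "\<And>x x'. x \<in> X \<Longrightarrow> x' \<in> X \<Longrightarrow> dist x x' < d' \<Longrightarrow> dist (ksec x) (ksec x') < d / (2 * m)"
    using d m unfolding uniformly_continuous_on_def
    by (metis dist_commute divide_pos_pos mult_pos_pos zero_less_numeral)
  show ?thesis
  proof (intro exI[of _ "min d' (d / 2)"] conjI ballI impI)
    show "0 < min d' (d / 2)" using d d' by simp
    fix z :: "'h ^ 'n" and s :: 'h and x y x' y'
    assume z: "z \<in> cball 0 \<beta>1" and s: "s \<in> cball 0 \<beta>2" and xy: "x \<in> X" "y \<in> Y" "x' \<in> X" "y' \<in> Y"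
      and close: "dist (x, y) (x', y') < min d' (d / 2)"
    define r where "r = dist (ksec x) (ksec x')"
    have "dist x x' < d'" "dist y y' < d / 2"
      using dist_fst_le[of "(x, y)" "(x', y')"] dist_snd_le[of "(x, y)" "(x', y')"] close by auto
    then have r: "0 \<le> r" "r < d / (2 * m)" and y: "dist y y' < d / 2"
      using d'(2) xy by (auto simp: r_def)
    have "dist (vec_eval evf z x) (vec_eval evf z x') + dist (evf s x) (evf s x')
        \<le> norm z * r + norm s * r"
      unfolding r_def by (intro add_mono dist_vec_eval_le dist_evf_le xy)
    also have "\<dots> \<le> m * r"
      unfolding distrib_right[symmetric] using r z s by (intro mult_right_mono) (auto simp: m_def)
    also have "\<dots> \<le> d / 2" using r m by (simp add: field_simps)
    finally show "\<bar>h (vec_eval evf z x) (evf s x) y - h (vec_eval evf z x') (evf s x') y'\<bar> \<le> e"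
      using y z s xy by (intro hd Rz Rs) auto
  qed
qed

lemma cost_bounded:
  fixes h :: "real ^ 'n \<Rightarrow> real \<Rightarrow> 'b::metric_space \<Rightarrow> real"
  assumes X: "compact X" and Y: "compact Y" and h: "continuous_on UNIV (\<lambda>(z, s, y). h z s y)"
  shows "\<exists>B. \<forall>z \<in> cball (0 :: 'h ^ 'n) \<beta>1. \<forall>s \<in> cball (0 :: 'h) \<beta>2. \<forall>x\<in>X. \<forall>y\<in>Y.
    \<bar>h (vec_eval evf z x) (evf s x) y\<bar> \<le> B"
proof -
  obtain R where Rz: "\<And>z :: 'h ^ 'n. \<And>x. norm z \<le> \<beta>1 \<Longrightarrow> x \<in> X \<Longrightarrow> norm (vec_eval evf z x) \<le> R"
    and Rs: "\<And>s x. norm s \<le> \<beta>2 \<Longrightarrow> x \<in> X \<Longrightarrow> \<bar>evf s x\<bar> \<le> R"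
    by (rule ball_values_bounded[OF X]) blast
  let ?D = "cball (0 :: real ^ 'n) R \<times> cball (0 :: real) R \<times> Y"
  have "bounded ((\<lambda>(z, s, y). h z s y) ` ?D)"
    by (intro compact_imp_bounded compact_continuous_image continuous_on_subset[OF h]
        compact_Times compact_cball Y) auto
  then obtain B where B: "\<forall>v \<in> (\<lambda>(z, s, y). h z s y) ` ?D. norm v \<le> B"
    unfolding bounded_iff by blast
  have "\<bar>h z s y\<bar> \<le> B" if "norm z \<le> R" "\<bar>s\<bar> \<le> R" "y \<in> Y" for z s y
    using B that by force
  then show ?thesis
    using Rz Rs by (intro exI[of _ B]) simp
qed

section \<open>Approximation by universality\<close>

text \<open>Universality on the compact set \<open>X\<close> itself approximates \<open>so\<close>
  and each component of \<open>zo\<close> uniformly. Uniform continuity of \<open>h\<close> turns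
  this into a pointwise cost error of at most \<open>e\<close>, which survives integration against a
  probability measure.\<close>

lemma universal_expected_cost_approx:
  fixes h :: "real ^ 'n \<Rightarrow> real \<Rightarrow> 'b::metric_space \<Rightarrow> real"
  assumes "prob_space P" and sets_P: "sets P = sets (restrict_space borel (X \<times> Y))"
    and X: "compact X" and Y: "compact Y" and universal: "universal_rkhs X evf"
    and h: "continuous_on UNIV (\<lambda>(z, s, y). h z s y)"
    and zo: "continuous_on X zo" and so: "continuous_on X so" and e: "e > 0"
  shows "\<exists>(z :: 'h ^ 'n) s. expected_cost P h (vec_eval evf z) (evf s) - expected_cost P h zo so \<le> e"
proof -
  interpret prob_space P by fact
  have space_P: "space P = X \<times> Y"
    using sets_eq_imp_space_eq[OF sets_P] by (simp add: space_restrict_space)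
  have "bounded (zo ` X)" "bounded (so ` X)"
    by (intro compact_imp_bounded compact_continuous_image zo so X)+
  then obtain R1 R2 where R: "\<And>x. x \<in> X \<Longrightarrow> norm (zo x) \<le> R1" "\<And>x. x \<in> X \<Longrightarrow> \<bar>so x\<bar> \<le> R2"
    by (auto simp: bounded_iff)
  \<comment> \<open>The extra 1 leaves room for the approximants, which stay within
    \<open>\<eta> \<le> 1\<close> of \<open>zo\<close> and \<open>so\<close>.\<close>
  define R where "R = max R1 R2 + 1"
  obtain d where d: "d > 0" and hd: "\<And>z z' s s' y y'. \<lbrakk>norm z \<le> R; norm z' \<le> R; \<bar>s\<bar> \<le> R; \<bar>s'\<bar> \<le> R;
      y \<in> Y; y' \<in> Y; dist z z' + dist s s' + dist y y' < d\<rbrakk> \<Longrightarrow> \<bar>h z s y - h z' s' y'\<bar> \<le> e"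
    by (rule cost_uniformly_continuous[OF h Y e]) blast
  \<comment> \<open>With a third of \<open>d\<close> for each of the two approximation errors, their
    sum stays strictly below \<open>d\<close>.\<close>
  define \<eta> where "\<eta> = min 1 (d / 3)"
  have \<eta>: "\<eta> > 0" "\<eta> \<le> 1" "\<eta> \<le> d / 3" using d by (auto simp: \<eta>_def)
  \<comment> \<open>The Euclidean norm is at most the sum of the absolute components, so errors of
    this size add up to \<open>\<eta>\<close>.\<close>
  have \<eta>n: "\<eta> / CARD('n) > 0" using \<eta> by simp
  obtain s where s: "\<And>x. x \<in> X \<Longrightarrow> \<bar>evf s x - so x\<bar> \<le> \<eta>"
    using universal so X \<eta> unfolding universal_rkhs_def by (meson order_refl)
  have "\<exists>g. \<forall>x\<in>X. \<bar>evf g x - zo x $ t\<bar> \<le> \<eta> / CARD('n)" for t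
    using universal X \<eta>n continuous_on_component[OF zo]
    unfolding universal_rkhs_def by (meson order_refl)
  then obtain g where g: "\<And>t x. x \<in> X \<Longrightarrow> \<bar>evf (g t) x - zo x $ t\<bar> \<le> \<eta> / CARD('n)"
    by metis
  define z :: "'h ^ 'n" where "z = (\<chi> t. g t)"
  have z: "dist (vec_eval evf z x) (zo x) \<le> \<eta>" if "x \<in> X" for x
  proof -
    have "dist (vec_eval evf z x) (zo x) \<le> (\<Sum>t\<in>UNIV. \<bar>(vec_eval evf z x - zo x) $ t\<bar>)"
      unfolding dist_norm by (rule norm_le_l1_cart)
    also have "\<dots> \<le> (\<Sum>t\<in>(UNIV :: 'n set). \<eta> / CARD('n))"
      using g[OF that] by (intro sum_mono) (simp add: vec_eval_def z_def)
    finally show ?thesis by simp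
  qed
  have close: "\<bar>h (vec_eval evf z x) (evf s x) y - h (zo x) (so x) y\<bar> \<le> e" if "x \<in> X" "y \<in> Y" for x y
  proof (rule hd)
    show "norm (zo x) \<le> R" "\<bar>so x\<bar> \<le> R" using R[OF that(1)] by (auto simp: R_def)
    show "norm (vec_eval evf z x) \<le> R"
      using z[OF that(1)] R(1)[OF that(1)] \<eta>(2) norm_triangle_sub[of "vec_eval evf z x" "zo x"]
      by (simp add: R_def dist_norm)
    show "\<bar>evf s x\<bar> \<le> R"
      using s[OF that(1)] R(2)[OF that(1)] \<eta>(2) by (simp add: R_def)
    show "dist (vec_eval evf z x) (zo x) + dist (evf s x) (so x) + dist y y < d"
      using z[OF that(1)] s[OF that(1)] \<eta> d by (simp add: dist_real_def)
  qed (fact that(2))+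
  have int: "integrable P (\<lambda>(x, y). h (u x) (v x) y)" if "continuous_on X u" "continuous_on X v" for u v
    by (intro integrable_continuous_on_compact[OF _ sets_P] continuous_on_cost[OF h that] compact_Times X Y
        finite_measure_axioms)
  note int = int[OF continuous_on_vec_eval continuous_on_evf] int[OF zo so]
  have "expected_cost P h (vec_eval evf z) (evf s) \<le> (\<integral>p. (case p of (x, y) \<Rightarrow> h (zo x) (so x) y) + e \<partial>P)"
    unfolding expected_cost_def using close int
    by (intro integral_mono Bochner_Integration.integrable_add) (fastforce simp: space_P)+
  also have "\<dots> = expected_cost P h zo so + e"
    unfolding expected_cost_def using int by (simp add: prob_space)
  finally show ?thesis by (auto simp: algebra_simps)
qed

section \<open>Deviation of empirical costs over the norm balls\<close>

text \<open>The costs of all pairs from the two balls form a bounded equicontinuous family on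
  \<open>X \<times> Y\<close>, to which the uniform deviation bound applies; hence \<open>E\<close>
  is chosen before \<open>z\<close> and \<open>s\<close>.\<close>

lemma cost_uniform_deviation:
  fixes h :: "real ^ 'n \<Rightarrow> real \<Rightarrow> 'b::metric_space \<Rightarrow> real"
  assumes "prob_space P" and sets_P: "sets P = sets (restrict_space borel (X \<times> Y))"
    and X: "compact X" and Y: "compact Y" and h: "continuous_on UNIV (\<lambda>(z, s, y). h z s y)"
    and e: "e > 0"
  obtains C \<beta> where "C > 0" "\<beta> > 0"
    "\<And>N. N > 0 \<Longrightarrow> \<exists>E \<in> sets (PiM (UNIV :: nat set) (\<lambda>_. P)).
       measure (PiM UNIV (\<lambda>_. P)) E \<le> C * exp (- real N * \<beta>) \<and>
       (\<forall>\<omega> \<in> space (PiM UNIV (\<lambda>_. P)) - E. \<forall>z \<in> cball (0 :: 'h ^ 'n) \<beta>1. \<forall>s \<in> cball 0 \<beta>2.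
          \<bar>expected_cost (empirical_measure \<omega> N) h (vec_eval evf z) (evf s)
            - expected_cost P h (vec_eval evf z) (evf s)\<bar> \<le> e)"
proof -
  interpret prob_space P by fact
  define c where "c = (\<lambda>(z :: 'h ^ 'n) s (x, y). h (vec_eval evf z x) (evf s x) y)"
  define F where "F = {c z s |z s. z \<in> cball 0 \<beta>1 \<and> s \<in> cball 0 \<beta>2}"
  from cost_bounded[OF X Y h, of \<beta>1 \<beta>2] obtain B where
    B: "\<forall>z \<in> cball (0 :: 'h ^ 'n) \<beta>1. \<forall>s \<in> cball (0 :: 'h) \<beta>2. \<forall>x\<in>X. \<forall>y\<in>Y.
      \<bar>h (vec_eval evf z x) (evf s x) y\<bar> \<le> B"
    by (elim exE)
  have equicont: "\<exists>d>0. \<forall>f\<in>F. \<forall>p\<in>X \<times> Y. \<forall>q\<in>X \<times> Y. dist p q < d \<longrightarrow> \<bar>f p - f q\<bar> \<le> e'"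
    if "e' > 0" for e'
  proof -
    from cost_equicontinuous[OF X Y h that, of \<beta>1 \<beta>2] obtain d where d: "d > 0" and
      hd: "\<forall>z \<in> cball (0 :: 'h ^ 'n) \<beta>1. \<forall>s \<in> cball (0 :: 'h) \<beta>2. \<forall>x\<in>X. \<forall>y\<in>Y. \<forall>x'\<in>X. \<forall>y'\<in>Y.
        dist (x, y) (x', y') < d \<longrightarrow>
        \<bar>h (vec_eval evf z x) (evf s x) y - h (vec_eval evf z x') (evf s x') y'\<bar> \<le> e'"
      by (elim exE conjE)
    show ?thesis
    proof (intro exI[of _ d] conjI d ballI impI)
      fix f p q assume "f \<in> F" "p \<in> X \<times> Y" "q \<in> X \<times> Y" "dist p q < d"
      then obtain z s where f: "f = c z s" and zs: "z \<in> cball 0 \<beta>1" "s \<in> cball 0 \<beta>2"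
        unfolding F_def by blast
      from hd[rule_format, OF zs, of "fst p" "snd p" "fst q" "snd q"]
      show "\<bar>f p - f q\<bar> \<le> e'"
        using \<open>p \<in> X \<times> Y\<close> \<open>q \<in> X \<times> Y\<close> \<open>dist p q < d\<close> by (simp add: f c_def case_prod_unfold mem_Times_iff)
    qed
  qed
  have bounded: "\<bar>f p\<bar> \<le> B" if "f \<in> F" "p \<in> X \<times> Y" for f p
  proof -
    obtain z s where f: "f = c z s" and zs: "z \<in> cball 0 \<beta>1" "s \<in> cball 0 \<beta>2"
      using \<open>f \<in> F\<close> unfolding F_def by blast
    show ?thesis
      using B[rule_format, OF zs, of "fst p" "snd p"] that(2) by (simp add: f c_def case_prod_unfold mem_Times_iff)
  qed
  have meas: "f \<in> borel_measurable P" if "f \<in> F" for f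
  proof -
    obtain z s where f: "f = c z s"
      using \<open>f \<in> F\<close> unfolding F_def by blast
    have "integrable P f"
      unfolding f c_def
      by (rule integrable_continuous_on_compact[OF finite_measure_axioms sets_P compact_Times[OF X Y]
          continuous_on_cost[OF h continuous_on_vec_eval continuous_on_evf]])
    then show ?thesis by (rule borel_measurable_integrable)
  qed
  show thesis
  proof (rule equicontinuous_uniform_deviation[where F = F and B = B and e = e,
        OF prob_space_axioms sets_P compact_Times[OF X Y]], fact equicont, fact bounded, fact meas, fact e)
    fix C \<beta> :: real
    assume C: "C > 0" "\<beta> > 0" and E: "\<And>N. N > 0 \<Longrightarrow> \<exists>E \<in> sets (PiM (UNIV :: nat set) (\<lambda>_. P)).
       measure (PiM UNIV (\<lambda>_. P)) E \<le> C * exp (- real N * \<beta>) \<and>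
       (\<forall>\<omega> \<in> space (PiM UNIV (\<lambda>_. P)) - E. \<forall>f\<in>F.
          \<bar>(\<Sum>i<N. f (\<omega> i)) / N - (\<integral>p. f p \<partial>P)\<bar> \<le> e)"
    have deviation: "expected_cost (empirical_measure \<omega> N) h (vec_eval evf z) (evf s)
          - expected_cost P h (vec_eval evf z) (evf s)
        = (\<Sum>i<N. c z s (\<omega> i)) / N - (\<integral>p. c z s p \<partial>P)" if "N > 0" for N \<omega> z s
      using that by (simp add: expected_cost_def integral_empirical_measure c_def)
    show thesis
    proof (rule that[OF C])
      fix N :: nat assume N: "N > 0"
      from E[OF N] obtain E where E: "E \<in> sets (PiM (UNIV :: nat set) (\<lambda>_. P))"
        "measure (PiM UNIV (\<lambda>_. P)) E \<le> C * exp (- real N * \<beta>)"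
        "\<forall>\<omega> \<in> space (PiM UNIV (\<lambda>_. P)) - E. \<forall>f\<in>F. \<bar>(\<Sum>i<N. f (\<omega> i)) / N - (\<integral>p. f p \<partial>P)\<bar> \<le> e"
        by blast
      have "c z s \<in> F" if "z \<in> cball 0 \<beta>1" "s \<in> cball 0 \<beta>2" for z s
        using that unfolding F_def by blast
      then show "\<exists>E \<in> sets (PiM (UNIV :: nat set) (\<lambda>_. P)).
         measure (PiM UNIV (\<lambda>_. P)) E \<le> C * exp (- real N * \<beta>) \<and>
         (\<forall>\<omega> \<in> space (PiM UNIV (\<lambda>_. P)) - E. \<forall>z \<in> cball (0 :: 'h ^ 'n) \<beta>1. \<forall>s \<in> cball 0 \<beta>2.
            \<bar>expected_cost (empirical_measure \<omega> N) h (vec_eval evf z) (evf s)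
              - expected_cost P h (vec_eval evf z) (evf s)\<bar> \<le> e)"
        unfolding deviation[OF N] using E by (intro bexI[of _ E] conjI ballI) (blast+)
    qed
  qed
qed

end

text \<open>A deterministic sandwich. Below: the penalty is nonnegative and no true cost is under
  \<open>V\<close>, so only the deviation \<open>e\<close> is lost. Above: the infimum is at most
  the objective at \<open>(zh, sh)\<close>, where \<open>\<delta>\<close> comes from suboptimality,
  one \<open>e\<close> from the deviation and one from the penalty.\<close>

lemma reg_value_deviation:
  fixes evf :: "'h::real_inner \<Rightarrow> 'a \<Rightarrow> real" and h :: "real ^ 'n \<Rightarrow> real \<Rightarrow> 'b \<Rightarrow> real"
    and zh :: "'h ^ 'n"
  assumes zh: "zh \<in> cball 0 \<beta>1" and sh: "sh \<in> cball 0 \<beta>2"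
    and dev: "\<And>z :: 'h ^ 'n. \<And>s. z \<in> cball 0 \<beta>1 \<Longrightarrow> s \<in> cball 0 \<beta>2 \<Longrightarrow>
      \<bar>expected_cost Q h (vec_eval evf z) (evf s) - expected_cost P h (vec_eval evf z) (evf s)\<bar> \<le> e"
    and lower: "\<And>z :: 'h ^ 'n. \<And>s. V \<le> expected_cost P h (vec_eval evf z) (evf s)"
    and upper: "expected_cost P h (vec_eval evf zh) (evf sh) \<le> V + \<delta>"
    and lam: "lam \<ge> 0" and penalty: "lam * (\<beta>1\<^sup>2 + \<beta>2\<^sup>2) \<le> e"
  shows "reg_value evf h \<beta>1 \<beta>2 Q lam \<in> {V - e..V + \<delta> + 2 * e}"
proof -
  define G where "G = (\<lambda>(z :: 'h ^ 'n, s).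
    expected_cost Q h (vec_eval evf z) (evf s) + lam * ((norm z)\<^sup>2 + (norm s)\<^sup>2))"
  let ?S = "cball (0 :: 'h ^ 'n) \<beta>1 \<times> cball (0 :: 'h) \<beta>2"
  have reg: "reg_value evf h \<beta>1 \<beta>2 Q lam = Inf (G ` ?S)"
    by (simp add: reg_value_def G_def)
  have G_ge: "V - e \<le> G p" if "p \<in> ?S" for p
  proof -
    obtain z s where p: "p = (z, s)" by (cases p)
    have "0 \<le> lam * ((norm z)\<^sup>2 + (norm s)\<^sup>2)" using lam by simp
    then show ?thesis
      using dev[of z s] lower[of z s] that by (simp add: p G_def)
  qed
  have mem: "(zh, sh) \<in> ?S" using zh sh by blast
  have "norm zh \<le> \<beta>1" "norm sh \<le> \<beta>2" using zh sh by simp_all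
  then have "lam * ((norm zh)\<^sup>2 + (norm sh)\<^sup>2) \<le> lam * (\<beta>1\<^sup>2 + \<beta>2\<^sup>2)"
    using lam by (intro mult_left_mono add_mono power_mono norm_ge_zero)
  with penalty dev[OF zh sh] upper have "G (zh, sh) \<le> V + \<delta> + 2 * e"
    by (simp add: G_def)
  \<comment> \<open>\<open>G_ge\<close> also supplies boundedness from below, which an infimum of
    reals requires to be a lower bound.\<close>
  moreover have "Inf (G ` ?S) \<le> G (zh, sh)"
    using G_ge mem by (intro cINF_lower bdd_belowI2)
  moreover have "V - e \<le> Inf (G ` ?S)"
    using mem by (intro cINF_greatest[OF _ G_ge]) blast
  ultimately show ?thesis by (simp add: reg)
qed

section \<open>Combining approximation, uniform deviation and the sandwich of the optimal
  value\<close>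

theorem theorem5p2:
  fixes X :: "(real ^ 'dx) set"
    and Y :: "(real ^ 'dy) set"
    and P :: "((real ^ 'dx) \<times> (real ^ 'dy)) measure"
    and k :: "real ^ 'dx \<Rightarrow> real ^ 'dx \<Rightarrow> real"
    and evf :: "'h::{real_inner, complete_space} \<Rightarrow> real ^ 'dx \<Rightarrow> real"
    and ksec :: "real ^ 'dx \<Rightarrow> 'h"
    and h :: "real ^ 'dz \<Rightarrow> real \<Rightarrow> real ^ 'dy \<Rightarrow> real"
    and zopt :: "real ^ 'dx \<Rightarrow> real ^ 'dz"
    and sopt :: "real ^ 'dx \<Rightarrow> real"
  assumes compact_XY: "compact (X \<times> Y)"
    and prob_P: "prob_space P"
    and sets_P: "sets P = sets (restrict_space borel (X \<times> Y))"
    and rkhs: "rkhs X k evf ksec"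
    and cont_k: "continuous_on (X \<times> X) (\<lambda>(x, x'). k x x')"
    and universal: "universal_rkhs X evf"
    and cont_h: "continuous_on UNIV (\<lambda>(z, s, y). h z s y)"
    and optimal: "optimal_solution X P h zopt sopt"
    and cond_d: "\<And>Z0 S0. compact (Z0 \<times> S0) \<Longrightarrow>
      \<exists>r \<nu>. continuous_on Y r \<and> (\<forall>y\<in>Y. 0 \<le> r y) \<and> integrable P (\<lambda>(x, y). r y) \<and>
        0 < \<nu> \<and> \<nu> < 1 \<and>
        (\<forall>z1\<in>Z0. \<forall>z2\<in>Z0. \<forall>s1\<in>S0. \<forall>s2\<in>S0. \<forall>y\<in>Y.
          \<bar>h z1 s1 y - h z2 s2 y\<bar> \<le> r y * (norm (z1 - z2) + \<bar>s1 - s2\<bar>) powr \<nu>)"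
  shows
    "(\<forall>\<delta>1>0. \<exists>(zh :: 'h ^ 'dz) (sh :: 'h).
        expected_cost P h (vec_eval evf zh) (evf sh) - expected_cost P h zopt sopt \<le> \<delta>1)
   \<and> (\<forall>\<delta>1>0. \<forall>(zh :: 'h ^ 'dz) (sh :: 'h) \<beta>1 \<beta>2 \<phi>.
        expected_cost P h (vec_eval evf zh) (evf sh) - expected_cost P h zopt sopt \<le> \<delta>1 \<longrightarrow>
        \<beta>1 = norm zh \<longrightarrow> \<beta>2 = norm sh \<longrightarrow>
        (continuous_on (X \<times> Y) \<phi> \<and> (\<forall>p \<in> X \<times> Y. 0 \<le> \<phi> p) \<and>
          (\<forall>z \<in> cball (0 :: 'h ^ 'dz) \<beta>1. \<forall>s \<in> cball 0 \<beta>2. \<forall>x\<in>X. \<forall>y\<in>Y.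
             \<bar>h (vec_eval evf z x) (evf s x) y\<bar> \<le> \<phi> (x, y)) \<and>
          integrable P \<phi> \<and>
          filterlim \<phi> at_top (inf at_infinity (principal (X \<times> Y)))) \<longrightarrow>
        (\<forall>X0 \<epsilon>. compact X0 \<longrightarrow> X0 \<subseteq> X \<longrightarrow> \<epsilon> > 0 \<longrightarrow>
          (\<exists>\<eta>>0. \<forall>x\<in>X0. \<forall>x'\<in>X0. norm (x' - x) \<le> \<eta> \<longrightarrow> norm (ksec x' - ksec x) \<le> \<epsilon>)) \<longrightarrow>
        (\<forall>z \<in> cball (0 :: 'h ^ 'dz) \<beta>1. \<forall>s \<in> cball 0 \<beta>2. \<forall>\<^sub>F t in nhds 0.
          integrable P (\<lambda>(x, y). exp (t * (h (vec_eval evf z x) (evf s x) y -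
                                  expected_cost P h (vec_eval evf z) (evf s))))) \<longrightarrow>
        (\<forall>\<delta>2>0. \<exists>(N0::nat) \<epsilon> C \<beta>.
          N0 > 0 \<and> \<epsilon> > 0 \<and> \<epsilon> < \<delta>2 / 6 \<and> C > 0 \<and> \<beta> > 0 \<and>
          (\<forall>N>N0. \<forall>lam>0.
            (\<beta>1\<^sup>2 + \<beta>2\<^sup>2 > 0 \<longrightarrow> lam \<le> \<epsilon> / (\<beta>1\<^sup>2 + \<beta>2\<^sup>2)) \<longrightarrow>
            \<P>(\<omega> in PiM (UNIV :: nat set) (\<lambda>_. P).
               \<bar>reg_value evf h \<beta>1 \<beta>2 (empirical_measure \<omega> N) lam - expected_cost P h zopt sopt\<bar>
                 \<ge> \<delta>1 + \<delta>2)
              \<le> C * exp (- real N * \<beta>))))"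
proof -
  interpret prob_space P by (rule prob_P)
  have "space P = X \<times> Y"
    using sets_eq_imp_space_eq[OF sets_P] by (simp add: space_restrict_space)
  \<comment> \<open>A probability space is nonempty; nonempty factors are the full projections of
    \<open>X \<times> Y\<close>, hence compact.\<close>
  then have "X \<noteq> {}" "Y \<noteq> {}"
    using not_empty by auto
  moreover have "compact (fst ` (X \<times> Y))" "compact (snd ` (X \<times> Y))"
    by (intro compact_continuous_image continuous_intros compact_XY)+
  ultimately have X: "compact X" and Y: "compact Y"
    by simp_all
  interpret continuous_rkhs X k evf ksec
    by (intro continuous_rkhs.intro continuous_rkhs_axioms.intro rkhs cont_k)
  let ?V = "expected_cost P h zopt sopt"
  let ?cost = "\<lambda>Q (z :: 'h ^ 'dz) s. expected_cost Q h (vec_eval evf z) (evf s)"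
  have zo: "continuous_on X zopt" and so: "continuous_on X sopt"
    using optimal by (auto simp: optimal_solution_def)
  \<comment> \<open>RKHS functions are continuous, so they compete in the problem that
    \<open>zopt\<close> and \<open>sopt\<close> solve.\<close>
  have lower: "?V \<le> ?cost P z s" for z s
    using optimal continuous_on_vec_eval continuous_on_evf by (auto simp: optimal_solution_def)
  have approx: "\<exists>(zh :: 'h ^ 'dz) (sh :: 'h). ?cost P zh sh - ?V \<le> \<delta>1" if "\<delta>1 > 0" for \<delta>1
    by (rule universal_expected_cost_approx[OF prob_P sets_P X Y universal cont_h zo so that])
  have tail: "\<exists>(N0::nat) \<epsilon> C \<beta>.
      N0 > 0 \<and> \<epsilon> > 0 \<and> \<epsilon> < \<delta>2 / 6 \<and> C > 0 \<and> \<beta> > 0 \<and>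
      (\<forall>N>N0. \<forall>lam>0.
        ((norm zh)\<^sup>2 + (norm sh)\<^sup>2 > 0 \<longrightarrow> lam \<le> \<epsilon> / ((norm zh)\<^sup>2 + (norm sh)\<^sup>2)) \<longrightarrow>
        \<P>(\<omega> in PiM (UNIV :: nat set) (\<lambda>_. P).
           \<bar>reg_value evf h (norm zh) (norm sh) (empirical_measure \<omega> N) lam - ?V\<bar> \<ge> \<delta>1 + \<delta>2)
          \<le> C * exp (- real N * \<beta>))"
    if \<delta>1: "\<delta>1 > 0" and \<delta>2: "\<delta>2 > 0" and upper: "?cost P zh sh - ?V \<le> \<delta>1"
    for \<delta>1 \<delta>2 and zh :: "'h ^ 'dz" and sh :: 'h
  proof -
    let ?M = "PiM (UNIV :: nat set) (\<lambda>_. P)"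
    interpret PM: product_prob_space "\<lambda>_. P" "UNIV :: nat set"
      by unfold_locales
    \<comment> \<open>A seventh is strictly below the required sixth, and \<open>2 * e\<close> stays
      strictly below \<open>\<delta>2\<close>, which makes the final deviation strict.\<close>
    define e where "e = \<delta>2 / 7"
    have e: "e > 0" using \<delta>2 by (simp add: e_def)
    have bound: "\<exists>C>0. \<exists>\<beta>>0. \<forall>N>0. \<exists>E \<in> sets ?M.
        measure ?M E \<le> C * exp (- real N * \<beta>) \<and>
        (\<forall>\<omega> \<in> space ?M - E. \<forall>z \<in> cball 0 (norm zh). \<forall>s \<in> cball 0 (norm sh).
          \<bar>?cost (empirical_measure \<omega> N) z s - ?cost P z s\<bar> \<le> e)"
      by (rule cost_uniform_deviation[where ?\<beta>1.0 = "norm zh" and ?\<beta>2.0 = "norm sh",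
            OF prob_P sets_P X Y cont_h e]) blast
    then obtain C \<beta> where C: "C > 0" "\<beta> > 0" and CE: "\<forall>N>0. \<exists>E \<in> sets ?M.
        measure ?M E \<le> C * exp (- real N * \<beta>) \<and>
        (\<forall>\<omega> \<in> space ?M - E. \<forall>z \<in> cball 0 (norm zh). \<forall>s \<in> cball 0 (norm sh).
          \<bar>?cost (empirical_measure \<omega> N) z s - ?cost P z s\<bar> \<le> e)"
      by (elim exE conjE)
    show ?thesis
    \<comment> \<open>The deviation bound holds for every positive \<open>N\<close>, so the
      threshold 1 suffices; \<open>e\<close>, \<open>C\<close> and \<open>\<beta>\<close> are fixed
      before \<open>N\<close> and \<open>lam\<close>.\<close>
    proof (rule exI[of _ 1], rule exI[of _ e], rule exI[of _ C], rule exI[of _ \<beta>], intro conjI allI impI)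
      fix N :: nat and lam :: real
      assume N: "1 < N" and lam: "0 < lam"
        and small: "(norm zh)\<^sup>2 + (norm sh)\<^sup>2 > 0 \<longrightarrow> lam \<le> e / ((norm zh)\<^sup>2 + (norm sh)\<^sup>2)"
      have "0 < N" using N by simp
      from CE[rule_format, OF this] obtain E where E: "E \<in> sets ?M"
          "measure ?M E \<le> C * exp (- real N * \<beta>)"
        and dev: "\<forall>\<omega> \<in> space ?M - E. \<forall>z \<in> cball 0 (norm zh). \<forall>s \<in> cball 0 (norm sh).
          \<bar>?cost (empirical_measure \<omega> N) z s - ?cost P z s\<bar> \<le> e"
        by (elim bexE conjE)
      \<comment> \<open>If both norms vanish, the premise does not restrict \<open>lam\<close>, but
        the penalty is then zero.\<close>
      have penalty: "lam * ((norm zh)\<^sup>2 + (norm sh)\<^sup>2) \<le> e"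
      proof (cases "(norm zh)\<^sup>2 + (norm sh)\<^sup>2 > 0")
        case True
        then show ?thesis using small by (simp add: pos_le_divide_eq)
      next
        case False
        then have "(norm zh)\<^sup>2 + (norm sh)\<^sup>2 = 0"
          by (metis antisym_conv1 sum_power2_ge_zero)
        then show ?thesis using e by simp
      qed
      have close: "\<bar>reg_value evf h (norm zh) (norm sh) (empirical_measure \<omega> N) lam - ?V\<bar> < \<delta>1 + \<delta>2"
        if "\<omega> \<in> space ?M - E" for \<omega>
      proof -
        have "reg_value evf h (norm zh) (norm sh) (empirical_measure \<omega> N) lam \<in> {?V - e..?V + \<delta>1 + 2 * e}"
        proof (rule reg_value_deviation[where zh = zh and sh = sh])
          show "\<bar>?cost (empirical_measure \<omega> N) z s - ?cost P z s\<bar> \<le> e"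
            if "z \<in> cball 0 (norm zh)" "s \<in> cball 0 (norm sh)" for z s
            using dev \<open>\<omega> \<in> space ?M - E\<close> that by blast
        qed (use lower upper lam penalty in auto)
        then show ?thesis using \<delta>1 \<delta>2 by (auto simp: e_def abs_less_iff)
      qed
      let ?A = "{\<omega> \<in> space ?M.
        \<bar>reg_value evf h (norm zh) (norm sh) (empirical_measure \<omega> N) lam - ?V\<bar> \<ge> \<delta>1 + \<delta>2}"
      have "?A \<subseteq> E" using close by fastforce
      \<comment> \<open>\<open>?A\<close> itself may fail to be measurable, hence the comparison with \<open>E\<close>.\<close>
      then have "measure ?M ?A \<le> measure ?M E"
        by (intro PM.finite_measure_mono E(1))
      also note E(2)
      finally show "measure ?M ?A \<le> C * exp (- real N * \<beta>)" .
    qed (use e C \<delta>2 in \<open>auto simp: e_def\<close>)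
  qed
  show ?thesis
    \<comment> \<open>\<open>hypsubst\<close> replaces the radii by the norms of \<open>zh\<close>
      and \<open>sh\<close>, the form in which \<open>tail\<close> is stated.\<close>
    by (intro conjI allI impI approx; (hypsubst, rule tail)?; assumption)
qed

end
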